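(* Let $L$ be a triassociative algebra and let $Z(L)$ be the center of $L$. If $Z(L)\subseteq Z^*(L)$, then $\omega(Z(E))=Z(L)$ for every stem extension $0\to\ker\omega\to E\xrightarrow{\omega}L\to0$.
   Context: Fix a field $\mathbb{F}$. A triassociative algebra is an $\mathbb{F}$-vector space $L$ with three bilinear products $\vdash,\dashv,\perp:L\times L\to L$ satisfying, for all $x,y,z\in L$: $(x\vdash y)\vdash z=x\vdash(y\vdash z)$; $(x\dashv y)\dashv z=x\dashv(y\dashv z)$; $(x\dashv y)\vdash z=x\vdash(y\vdash z)$; $(x\dashv y)\dashv z=x\dashv(y\vdash z)$; $(x\vdash y)\dashv z=x\vdash(y\dashv z)$; $(x\perp y)\vdash z=x\vdash(y\vdash z)$; $(x\dashv y)\dashv z=x\dashv(y\perp z)$; $(x\vdash y)\perp z=x\vdash(y\perp z)$; $(x\perp y)\dashv z=x\perp(y\dashv z)$; $(x\dashv y)\perp z=x\perp(y\vdash z)$; $(x\perp y)\perp z=x\perp(y\perp z)$. Homomorphisms are linear maps preserving all three products. The center $Z(L)$ is the set of all $z\in L$ with $z*x=x*z=0$ for all $x\in L$ and $*\in\{\vdash,\dashv,\perp\}$. $L'=L\vdash L+L\dashv L+L\perp L$, where $L*L$ is the span of all $x*y$. An extension $0\to\ker\omega\to E\xrightarrow{\omega}L\to0$ (a short exact sequence of homomorphisms of triassociative algebras) is central if $\ker\omega\subseteq Z(E)$; a central extension is stem if moreover $\ker\omega\subseteq E'$. $Z^*(L)$ denotes the intersection of all images $\omega(Z(E))$ over all central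 extensions $0\to\ker\omega\to E\xrightarrow{\omega}L\to0$ of $L$. *)

theory Defs
  imports "HOL-Algebra.Module" "HOL-Algebra.AbelCoset"
begin

no_notation bottom (\<open>\<bottom>\<index>\<close>)

text \<open>
  The record extends \<^type>\<open>module_ext\<close>, so it inherits the ring fields \<^const>\<open>mult\<close> and
  \<^const>\<open>one\<close>. The locale \<^locale>\<open>module\<close> puts no condition on them, and neither does anything
  below: they carry no information.
\<close>

record ('f, 'a) triassoc = "('f, 'a) module" +
  lprod :: "'a \<Rightarrow> 'a \<Rightarrow> 'a" (infixl \<open>\<turnstile>\<index>\<close> 70)
  rprod :: "'a \<Rightarrow> 'a \<Rightarrow> 'a" (infixl \<open>\<stileturn>\<index>\<close> 70)
  mprod :: "'a \<Rightarrow> 'a \<Rightarrow> 'a" (infixl \<open>\<bottom>\<index>\<close> 70)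

definition bilinear_product ::
    "('f, 'm) ring_scheme \<Rightarrow> ('f, 'a, 'n) module_scheme \<Rightarrow> ('a \<Rightarrow> 'a \<Rightarrow> 'a) \<Rightarrow> bool" where
  "bilinear_product F V b \<longleftrightarrow>
     (\<forall>x\<in>carrier V. \<forall>y\<in>carrier V. b x y \<in> carrier V) \<and>
     (\<forall>x\<in>carrier V. \<forall>x'\<in>carrier V. \<forall>y\<in>carrier V. b (x \<oplus>\<^bsub>V\<^esub> x') y = b x y \<oplus>\<^bsub>V\<^esub> b x' y) \<and>
     (\<forall>x\<in>carrier V. \<forall>y\<in>carrier V. \<forall>y'\<in>carrier V. b x (y \<oplus>\<^bsub>V\<^esub> y') = b x y \<oplus>\<^bsub>V\<^esub> b x y') \<and>
     (\<forall>a\<in>carrier F. \<forall>x\<in>carrier V. \<forall>y\<in>carrier V. b (a \<odot>\<^bsub>V\<^esub> x) y = a \<odot>\<^bsub>V\<^esub> b x y) \<and>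
     (\<forall>a\<in>carrier F. \<forall>x\<in>carrier V. \<forall>y\<in>carrier V. b x (a \<odot>\<^bsub>V\<^esub> y) = a \<odot>\<^bsub>V\<^esub> b x y)"

locale triassociative_algebra = field F + module F L
  for F :: "('f, 'm) ring_scheme" and L :: "('f, 'a, 'n) triassoc_scheme" (structure) +
  assumes bilinear: "bilinear_product F L (lprod L)"
      "bilinear_product F L (rprod L)"
      "bilinear_product F L (mprod L)"
    and triassoc:
      "\<lbrakk>x \<in> carrier L; y \<in> carrier L; z \<in> carrier L\<rbrakk> \<Longrightarrow> (x \<turnstile> y) \<turnstile> z = x \<turnstile> (y \<turnstile> z)"
      "\<lbrakk>x \<in> carrier L; y \<in> carrier L; z \<in> carrier L\<rbrakk> \<Longrightarrow> (x \<stileturn> y) \<stileturn> z = x \<stileturn> (y \<stileturn> z)"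
      "\<lbrakk>x \<in> carrier L; y \<in> carrier L; z \<in> carrier L\<rbrakk> \<Longrightarrow> (x \<stileturn> y) \<turnstile> z = x \<turnstile> (y \<turnstile> z)"
      "\<lbrakk>x \<in> carrier L; y \<in> carrier L; z \<in> carrier L\<rbrakk> \<Longrightarrow> (x \<stileturn> y) \<stileturn> z = x \<stileturn> (y \<turnstile> z)"
      "\<lbrakk>x \<in> carrier L; y \<in> carrier L; z \<in> carrier L\<rbrakk> \<Longrightarrow> (x \<turnstile> y) \<stileturn> z = x \<turnstile> (y \<stileturn> z)"
      "\<lbrakk>x \<in> carrier L; y \<in> carrier L; z \<in> carrier L\<rbrakk> \<Longrightarrow> (x \<bottom> y) \<turnstile> z = x \<turnstile> (y \<turnstile> z)"
      "\<lbrakk>x \<in> carrier L; y \<in> carrier L; z \<in> carrier L\<rbrakk> \<Longrightarrow> (x \<stileturn> y) \<stileturn> z = x \<stileturn> (y \<bottom> z)"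
      "\<lbrakk>x \<in> carrier L; y \<in> carrier L; z \<in> carrier L\<rbrakk> \<Longrightarrow> (x \<turnstile> y) \<bottom> z = x \<turnstile> (y \<bottom> z)"
      "\<lbrakk>x \<in> carrier L; y \<in> carrier L; z \<in> carrier L\<rbrakk> \<Longrightarrow> (x \<bottom> y) \<stileturn> z = x \<bottom> (y \<stileturn> z)"
      "\<lbrakk>x \<in> carrier L; y \<in> carrier L; z \<in> carrier L\<rbrakk> \<Longrightarrow> (x \<stileturn> y) \<bottom> z = x \<bottom> (y \<turnstile> z)"
      "\<lbrakk>x \<in> carrier L; y \<in> carrier L; z \<in> carrier L\<rbrakk> \<Longrightarrow> (x \<bottom> y) \<bottom> z = x \<bottom> (y \<bottom> z)"

definition triassoc_hom ::
    "('f, 'm) ring_scheme \<Rightarrow> ('f, 'a, 'n) triassoc_scheme \<Rightarrow> ('f, 'b, 'k) triassoc_scheme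
      \<Rightarrow> ('a \<Rightarrow> 'b) set" where
  "triassoc_hom F A B = {h \<in> carrier A \<rightarrow> carrier B.
     (\<forall>x\<in>carrier A. \<forall>y\<in>carrier A. h (x \<oplus>\<^bsub>A\<^esub> y) = h x \<oplus>\<^bsub>B\<^esub> h y) \<and>
     (\<forall>a\<in>carrier F. \<forall>x\<in>carrier A. h (a \<odot>\<^bsub>A\<^esub> x) = a \<odot>\<^bsub>B\<^esub> h x) \<and>
     (\<forall>x\<in>carrier A. \<forall>y\<in>carrier A. h (x \<turnstile>\<^bsub>A\<^esub> y) = h x \<turnstile>\<^bsub>B\<^esub> h y) \<and>
     (\<forall>x\<in>carrier A. \<forall>y\<in>carrier A. h (x \<stileturn>\<^bsub>A\<^esub> y) = h x \<stileturn>\<^bsub>B\<^esub> h y) \<and>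
     (\<forall>x\<in>carrier A. \<forall>y\<in>carrier A. h (x \<bottom>\<^bsub>A\<^esub> y) = h x \<bottom>\<^bsub>B\<^esub> h y)}"

definition center :: "('f, 'a, 'n) triassoc_scheme \<Rightarrow> 'a set" where
  "center L = {z \<in> carrier L. \<forall>x\<in>carrier L.
     z \<turnstile>\<^bsub>L\<^esub> x = \<zero>\<^bsub>L\<^esub> \<and> x \<turnstile>\<^bsub>L\<^esub> z = \<zero>\<^bsub>L\<^esub> \<and>
     z \<stileturn>\<^bsub>L\<^esub> x = \<zero>\<^bsub>L\<^esub> \<and> x \<stileturn>\<^bsub>L\<^esub> z = \<zero>\<^bsub>L\<^esub> \<and>
     z \<bottom>\<^bsub>L\<^esub> x = \<zero>\<^bsub>L\<^esub> \<and> x \<bottom>\<^bsub>L\<^esub> z = \<zero>\<^bsub>L\<^esub>}"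

definition lin_span :: "('f, 'm) ring_scheme \<Rightarrow> ('f, 'a, 'n) module_scheme \<Rightarrow> 'a set \<Rightarrow> 'a set" where
  "lin_span F V S = \<Inter>{H. submodule H F V \<and> S \<subseteq> H}"

definition prod_span ::
    "('f, 'm) ring_scheme \<Rightarrow> ('f, 'a, 'n) module_scheme \<Rightarrow> ('a \<Rightarrow> 'a \<Rightarrow> 'a) \<Rightarrow> 'a set" where
  "prod_span F V b = lin_span F V {b x y | x y. x \<in> carrier V \<and> y \<in> carrier V}"

definition derived_algebra :: "('f, 'm) ring_scheme \<Rightarrow> ('f, 'a, 'n) triassoc_scheme \<Rightarrow> 'a set" where
  "derived_algebra F L =
     prod_span F L (lprod L) <+>\<^bsub>L\<^esub> prod_span F L (rprod L) <+>\<^bsub>L\<^esub> prod_span F L (mprod L)"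

text \<open>
  In \<open>0 \<rightarrow> ker \<omega> \<rightarrow> E \<rightarrow> L \<rightarrow> 0\<close> the first map is the inclusion, so exactness amounts to
  surjectivity of \<open>\<omega>\<close>.
\<close>

definition extension ::
    "('f, 'm) ring_scheme \<Rightarrow> ('f, 'e, 'n) triassoc_scheme \<Rightarrow> ('f, 'a, 'k) triassoc_scheme
      \<Rightarrow> ('e \<Rightarrow> 'a) \<Rightarrow> bool" where
  "extension F E L \<omega> \<longleftrightarrow>
     triassociative_algebra F E \<and> triassociative_algebra F L \<and>
     \<omega> \<in> triassoc_hom F E L \<and> \<omega> ` carrier E = carrier L"

definition central_extension ::
    "('f, 'm) ring_scheme \<Rightarrow> ('f, 'e, 'n) triassoc_scheme \<Rightarrow> ('f, 'a, 'k) triassoc_scheme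
      \<Rightarrow> ('e \<Rightarrow> 'a) \<Rightarrow> bool" where
  "central_extension F E L \<omega> \<longleftrightarrow> extension F E L \<omega> \<and> a_kernel E L \<omega> \<subseteq> center E"

definition stem_extension ::
    "('f, 'm) ring_scheme \<Rightarrow> ('f, 'e, 'n) triassoc_scheme \<Rightarrow> ('f, 'a, 'k) triassoc_scheme
      \<Rightarrow> ('e \<Rightarrow> 'a) \<Rightarrow> bool" where
  "stem_extension F E L \<omega> \<longleftrightarrow>
     central_extension F E L \<omega> \<and> a_kernel E L \<omega> \<subseteq> derived_algebra F E"

text \<open>
  A term cannot quantify over types, so the carriers of the central extensions in \<open>Z\<^sup>*\<close> have to be
  drawn from one type. Subsets of \<^typ>\<open>'a \<times> 'f\<close> suffice to obtain the intersection over
  all central extensions, whatever their size; this is lemma \<open>Zstar_subset_image\<close> below.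
\<close>

definition Zstar :: "('f, 'm) ring_scheme \<Rightarrow> ('f, 'a, 'k) triassoc_scheme \<Rightarrow> 'a set" where
  "Zstar F L = \<Inter>{\<omega> ` center E | (E :: ('f, 'a \<times> 'f) triassoc) \<omega>. central_extension F E L \<omega>}"

lemma (in triassociative_algebra) prod_closed:
  assumes "x \<in> carrier L" "y \<in> carrier L"
  shows "x \<turnstile> y \<in> carrier L" "x \<stileturn> y \<in> carrier L" "x \<bottom> y \<in> carrier L"
  using assms bilinear(1)[unfolded bilinear_product_def, THEN conjunct1]
    bilinear(2)[unfolded bilinear_product_def, THEN conjunct1]
    bilinear(3)[unfolded bilinear_product_def, THEN conjunct1] by blast+

lemma exists_separating_functional:
  assumes alg: "triassociative_algebra F E" and c: "c \<in> carrier E" "c \<noteq> \<zero>\<^bsub>E\<^esub>"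
  shows "\<exists>\<phi>. \<phi> \<in> carrier E \<rightarrow> carrier F \<and>
    (\<forall>x\<in>carrier E. \<forall>y\<in>carrier E. \<phi> (x \<oplus>\<^bsub>E\<^esub> y) = \<phi> x \<oplus>\<^bsub>F\<^esub> \<phi> y) \<and>
    (\<forall>a\<in>carrier F. \<forall>x\<in>carrier E. \<phi> (a \<odot>\<^bsub>E\<^esub> x) = a \<otimes>\<^bsub>F\<^esub> \<phi> x) \<and> \<phi> c = \<one>\<^bsub>F\<^esub>"
proof -
  interpret E: triassociative_algebra F E by fact
  let ?P = "\<lambda>N. submodule N F E \<and> c \<notin> N"
  have ne: "{N. ?P N} \<noteq> {}"
  proof -
    have "submodule {\<zero>\<^bsub>E\<^esub>} F E" by (rule E.submoduleI) auto
    then show ?thesis using c by auto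
  qed
  have "\<exists>N\<in>{N. ?P N}. \<forall>X\<in>{N. ?P N}. N \<subseteq> X \<longrightarrow> X = N"
  proof (rule subset_Zorn_nonempty[OF ne])
    fix C assume C: "C \<noteq> {}" and ch: "subset.chain {N. ?P N} C"
    have sub: "submodule X F E" "c \<notin> X" if "X \<in> C" for X
      using ch that unfolding subset.chain_def by auto
    note subE = E.submoduleE[OF sub(1)]
    have "submodule (\<Union>C) F E"
    proof (rule E.submoduleI)
      show "\<Union>C \<subseteq> carrier E" using subE(1) by blast
      obtain X where "X \<in> C" using C by blast
      then have "\<zero>\<^bsub>E\<^esub> \<in> X"
        using sub(1) submodule.axioms(1) subgroup.one_closed by fastforce
      then show "\<zero>\<^bsub>E\<^esub> \<in> \<Union>C" using \<open>X \<in> C\<close> by blast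
      show "\<ominus>\<^bsub>E\<^esub> a \<in> \<Union>C" if "a \<in> \<Union>C" for a using that subE(3) by blast
      show "a \<odot>\<^bsub>E\<^esub> x \<in> \<Union>C" if "a \<in> carrier F" "x \<in> \<Union>C" for a x using that subE(4) by blast
      fix a b assume "a \<in> \<Union>C" "b \<in> \<Union>C"
      then obtain X Y where XY: "X \<in> C" "Y \<in> C" "a \<in> X" "b \<in> Y" by blast
      then have "X \<subseteq> Y \<or> Y \<subseteq> X" using ch unfolding subset.chain_def by blast
      then show "a \<oplus>\<^bsub>E\<^esub> b \<in> \<Union>C"
        using XY subE(5)[of X a b] subE(5)[of Y a b] by blast
    qed
    then show "\<Union>C \<in> {N. ?P N}" using sub(2) by auto
  qed
  then obtain N where N: "submodule N F E" "c \<notin> N"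
    and max: "\<And>X. submodule X F E \<Longrightarrow> c \<notin> X \<Longrightarrow> N \<subseteq> X \<Longrightarrow> X = N" by blast
  note NE = E.submoduleE[OF N(1)]
  have N0: "\<zero>\<^bsub>E\<^esub> \<in> N" using N(1) submodule.axioms(1) subgroup.one_closed by fastforce
  have Nc: "n \<in> carrier E" if "n \<in> N" for n using that NE(1) by blast
  have ex: "\<exists>a\<in>carrier F. \<exists>n\<in>N. e = n \<oplus>\<^bsub>E\<^esub> a \<odot>\<^bsub>E\<^esub> c" if e: "e \<in> carrier E" for e
  proof (cases "e \<in> N")
    case True
    then show ?thesis using Nc c N0 by (intro bexI[of _ "\<zero>\<^bsub>F\<^esub>"] bexI[of _ e]) auto
  next
    case False
    let ?X = "{n \<oplus>\<^bsub>E\<^esub> a \<odot>\<^bsub>E\<^esub> e | n a. n \<in> N \<and> a \<in> carrier F}"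
    have sX: "submodule ?X F E"
    proof (rule E.submoduleI)
      show "?X \<subseteq> carrier E" using Nc e by auto
      show "\<zero>\<^bsub>E\<^esub> \<in> ?X" using N0 e
        by (intro CollectI exI[of _ "\<zero>\<^bsub>E\<^esub>"] exI[of _ "\<zero>\<^bsub>F\<^esub>"]) auto
      show "\<ominus>\<^bsub>E\<^esub> a \<in> ?X" if a: "a \<in> ?X" for a
      proof -
        from a obtain n b where nb: "n \<in> N" "b \<in> carrier F" "a = n \<oplus>\<^bsub>E\<^esub> b \<odot>\<^bsub>E\<^esub> e" by blast
        then have "\<ominus>\<^bsub>E\<^esub> a = \<ominus>\<^bsub>E\<^esub> n \<oplus>\<^bsub>E\<^esub> (\<ominus>\<^bsub>F\<^esub> b) \<odot>\<^bsub>E\<^esub> e"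
          using Nc e by (simp add: E.minus_add E.smult_l_minus)
        then show ?thesis using nb NE(3) by blast
      qed
      show "a \<oplus>\<^bsub>E\<^esub> b \<in> ?X" if ab: "a \<in> ?X" "b \<in> ?X" for a b
      proof -
        from ab obtain n r m s where nr: "n \<in> N" "r \<in> carrier F" "a = n \<oplus>\<^bsub>E\<^esub> r \<odot>\<^bsub>E\<^esub> e"
          "m \<in> N" "s \<in> carrier F" "b = m \<oplus>\<^bsub>E\<^esub> s \<odot>\<^bsub>E\<^esub> e" by blast
        then have "a \<oplus>\<^bsub>E\<^esub> b = (n \<oplus>\<^bsub>E\<^esub> m) \<oplus>\<^bsub>E\<^esub> (r \<oplus>\<^bsub>F\<^esub> s) \<odot>\<^bsub>E\<^esub> e"
          using Nc e by (simp add: E.smult_l_distr E.M.add.m_ac)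
        then show ?thesis using nr NE(5) by blast
      qed
      show "a \<odot>\<^bsub>E\<^esub> x \<in> ?X" if ax: "a \<in> carrier F" "x \<in> ?X" for a x
      proof -
        from ax obtain n r where nr: "n \<in> N" "r \<in> carrier F" "x = n \<oplus>\<^bsub>E\<^esub> r \<odot>\<^bsub>E\<^esub> e" by blast
        then have "a \<odot>\<^bsub>E\<^esub> x = a \<odot>\<^bsub>E\<^esub> n \<oplus>\<^bsub>E\<^esub> (a \<otimes>\<^bsub>F\<^esub> r) \<odot>\<^bsub>E\<^esub> e"
          using Nc e ax by (simp add: E.smult_r_distr E.smult_assoc1)
        then show ?thesis using nr ax NE(4) by blast
      qed
    qed
    have "N \<subseteq> ?X"
    proof
      fix n assume "n \<in> N"
      then show "n \<in> ?X" using Nc e by (intro CollectI exI[of _ n] exI[of _ "\<zero>\<^bsub>F\<^esub>"]) auto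
    qed
    moreover have "e \<in> ?X" using N0 e
      by (intro CollectI exI[of _ "\<zero>\<^bsub>E\<^esub>"] exI[of _ "\<one>\<^bsub>F\<^esub>"]) auto
    ultimately have "c \<in> ?X" using max[OF sX] False by blast
    then obtain n a where na: "n \<in> N" "a \<in> carrier F" "c = n \<oplus>\<^bsub>E\<^esub> a \<odot>\<^bsub>E\<^esub> e" by blast
    have "a \<noteq> \<zero>\<^bsub>F\<^esub>" using na N(2) e Nc by auto
    then have inv: "inv\<^bsub>F\<^esub> a \<in> carrier F" "inv\<^bsub>F\<^esub> a \<otimes>\<^bsub>F\<^esub> a = \<one>\<^bsub>F\<^esub>"
      using na E.field_Units by auto
    have "inv\<^bsub>F\<^esub> a \<odot>\<^bsub>E\<^esub> c = inv\<^bsub>F\<^esub> a \<odot>\<^bsub>E\<^esub> n \<oplus>\<^bsub>E\<^esub> (inv\<^bsub>F\<^esub> a \<otimes>\<^bsub>F\<^esub> a) \<odot>\<^bsub>E\<^esub> e"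
      using na e Nc inv(1) by (simp add: E.smult_r_distr E.smult_assoc1)
    then have "inv\<^bsub>F\<^esub> a \<odot>\<^bsub>E\<^esub> c = inv\<^bsub>F\<^esub> a \<odot>\<^bsub>E\<^esub> n \<oplus>\<^bsub>E\<^esub> e"
      using inv e by simp
    then have "e = \<ominus>\<^bsub>E\<^esub> (inv\<^bsub>F\<^esub> a \<odot>\<^bsub>E\<^esub> n) \<oplus>\<^bsub>E\<^esub> inv\<^bsub>F\<^esub> a \<odot>\<^bsub>E\<^esub> c"
      using inv e na Nc by (simp add: E.M.r_neg1)
    moreover have "\<ominus>\<^bsub>E\<^esub> (inv\<^bsub>F\<^esub> a \<odot>\<^bsub>E\<^esub> n) \<in> N" using inv na NE by blast
    ultimately show ?thesis using inv(1) by blast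
  qed
  have uniq: "a = b" if "a \<in> carrier F" "b \<in> carrier F" "n \<in> N" "m \<in> N"
    "n \<oplus>\<^bsub>E\<^esub> a \<odot>\<^bsub>E\<^esub> c = m \<oplus>\<^bsub>E\<^esub> b \<odot>\<^bsub>E\<^esub> c" for a b n m
  proof (rule ccontr)
    assume "a \<noteq> b"
    let ?d = "a \<ominus>\<^bsub>F\<^esub> b"
    have ab: "abelian_group F"
      using E.field_axioms by (simp add: field_def domain_def cring_def ring_def)
    have d: "?d \<in> carrier F" "?d \<noteq> \<zero>\<^bsub>F\<^esub>"
      using that \<open>a \<noteq> b\<close> abelian_group.minus_equality[OF ab, of a "\<ominus>\<^bsub>F\<^esub> b"] abelian_group.minus_minus[OF ab, of b]
      abelian_group.a_inv_closed[OF ab, of b]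
      by (auto simp: a_minus_def)
    have "?d \<odot>\<^bsub>E\<^esub> c = \<ominus>\<^bsub>E\<^esub> n \<oplus>\<^bsub>E\<^esub> (n \<oplus>\<^bsub>E\<^esub> a \<odot>\<^bsub>E\<^esub> c) \<oplus>\<^bsub>E\<^esub> \<ominus>\<^bsub>E\<^esub> (b \<odot>\<^bsub>E\<^esub> c)"
      using that(1-4) Nc c by (simp add: a_minus_def E.smult_l_distr E.smult_l_minus E.M.r_neg1)
    also have "\<dots> = \<ominus>\<^bsub>E\<^esub> n \<oplus>\<^bsub>E\<^esub> m"
      using that Nc c by (simp add: E.M.a_assoc E.M.r_neg)
    finally have "?d \<odot>\<^bsub>E\<^esub> c \<in> N" using that NE by auto
    then have "inv\<^bsub>F\<^esub> ?d \<odot>\<^bsub>E\<^esub> (?d \<odot>\<^bsub>E\<^esub> c) \<in> N" using d E.field_Units NE(4) by auto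
    moreover have "inv\<^bsub>F\<^esub> ?d \<odot>\<^bsub>E\<^esub> (?d \<odot>\<^bsub>E\<^esub> c) = c"
      using d E.field_Units c by (simp flip: E.smult_assoc1)
    ultimately show False using N(2) by simp
  qed
  define \<phi> where "\<phi> e = (SOME a. a \<in> carrier F \<and> (\<exists>n\<in>N. e = n \<oplus>\<^bsub>E\<^esub> a \<odot>\<^bsub>E\<^esub> c))" for e
  have \<phi>: "\<phi> e \<in> carrier F \<and> (\<exists>n\<in>N. e = n \<oplus>\<^bsub>E\<^esub> \<phi> e \<odot>\<^bsub>E\<^esub> c)" if "e \<in> carrier E" for e
    unfolding \<phi>_def by (rule someI_ex) (use ex[OF that] in blast)
  have \<phi>I: "\<phi> e = a" if "a \<in> carrier F" "n \<in> N" "e = n \<oplus>\<^bsub>E\<^esub> a \<odot>\<^bsub>E\<^esub> c" for e a n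
  proof -
    have "e \<in> carrier E" using that Nc c by auto
    then obtain m where "m \<in> N" "e = m \<oplus>\<^bsub>E\<^esub> \<phi> e \<odot>\<^bsub>E\<^esub> c" "\<phi> e \<in> carrier F" using \<phi> by blast
    then show ?thesis using uniq that by metis
  qed
  have "\<phi> (x \<oplus>\<^bsub>E\<^esub> y) = \<phi> x \<oplus>\<^bsub>F\<^esub> \<phi> y" if xy: "x \<in> carrier E" "y \<in> carrier E" for x y
  proof -
    obtain n m where nm: "n \<in> N" "x = n \<oplus>\<^bsub>E\<^esub> \<phi> x \<odot>\<^bsub>E\<^esub> c" "m \<in> N" "y = m \<oplus>\<^bsub>E\<^esub> \<phi> y \<odot>\<^bsub>E\<^esub> c"
      and F: "\<phi> x \<in> carrier F" "\<phi> y \<in> carrier F" using \<phi> xy by meson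
    have "x \<oplus>\<^bsub>E\<^esub> y = (n \<oplus>\<^bsub>E\<^esub> \<phi> x \<odot>\<^bsub>E\<^esub> c) \<oplus>\<^bsub>E\<^esub> (m \<oplus>\<^bsub>E\<^esub> \<phi> y \<odot>\<^bsub>E\<^esub> c)"
      using nm by simp
    also have "\<dots> = (n \<oplus>\<^bsub>E\<^esub> m) \<oplus>\<^bsub>E\<^esub> (\<phi> x \<oplus>\<^bsub>F\<^esub> \<phi> y) \<odot>\<^bsub>E\<^esub> c"
      using nm(1,3) F c Nc by (simp add: E.smult_l_distr E.M.add.m_ac)
    finally show ?thesis using \<phi>I[OF _ NE(5)] nm(1,3) F by blast
  qed
  moreover have "\<phi> (a \<odot>\<^bsub>E\<^esub> x) = a \<otimes>\<^bsub>F\<^esub> \<phi> x" if ax: "a \<in> carrier F" "x \<in> carrier E" for a x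
  proof -
    obtain n where n: "n \<in> N" "x = n \<oplus>\<^bsub>E\<^esub> \<phi> x \<odot>\<^bsub>E\<^esub> c" and F: "\<phi> x \<in> carrier F"
      using \<phi> ax by meson
    have "a \<odot>\<^bsub>E\<^esub> x = a \<odot>\<^bsub>E\<^esub> (n \<oplus>\<^bsub>E\<^esub> \<phi> x \<odot>\<^bsub>E\<^esub> c)" using n by simp
    also have "\<dots> = a \<odot>\<^bsub>E\<^esub> n \<oplus>\<^bsub>E\<^esub> (a \<otimes>\<^bsub>F\<^esub> \<phi> x) \<odot>\<^bsub>E\<^esub> c"
      using n(1) F c Nc ax by (simp add: E.smult_r_distr E.smult_assoc1)
    finally show ?thesis using \<phi>I[OF _ NE(4)] n(1) F ax by blast
  qed
  moreover have "\<phi> c = \<one>\<^bsub>F\<^esub>" by (rule \<phi>I[OF _ N0]) (use c in auto)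
  ultimately show ?thesis using \<phi> by (intro exI[of _ \<phi>]) auto
qed

lemma central_extension_into_product:
  fixes L :: "('f, 'a, 'k) triassoc_scheme" and E :: "('f, 'e, 'n) triassoc_scheme"
  assumes ce: "central_extension F E L \<omega>"
    and \<phi>: "\<phi> \<in> carrier E \<rightarrow> carrier F"
      "\<And>x y. x \<in> carrier E \<Longrightarrow> y \<in> carrier E \<Longrightarrow> \<phi> (x \<oplus>\<^bsub>E\<^esub> y) = \<phi> x \<oplus>\<^bsub>F\<^esub> \<phi> y"
      "\<And>a x. a \<in> carrier F \<Longrightarrow> x \<in> carrier E \<Longrightarrow> \<phi> (a \<odot>\<^bsub>E\<^esub> x) = a \<otimes>\<^bsub>F\<^esub> \<phi> x"
  shows "\<exists>E1 :: ('f, 'a \<times> 'f) triassoc. central_extension F E1 L fst \<and>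
    (\<lambda>x. (\<omega> x, \<phi> x)) \<in> triassoc_hom F E E1 \<and> (\<lambda>x. (\<omega> x, \<phi> x)) ` carrier E = carrier E1 \<and>
    \<zero>\<^bsub>E1\<^esub> = (\<zero>\<^bsub>L\<^esub>, \<zero>\<^bsub>F\<^esub>)"
proof -
  interpret E: triassociative_algebra F E
    using ce unfolding central_extension_def extension_def by blast
  interpret L: triassociative_algebra F L
    using ce unfolding central_extension_def extension_def by blast
  have \<omega>c: "\<And>x. x \<in> carrier E \<Longrightarrow> \<omega> x \<in> carrier L"
    and \<omega>a: "\<And>x y. x \<in> carrier E \<Longrightarrow> y \<in> carrier E \<Longrightarrow> \<omega> (x \<oplus>\<^bsub>E\<^esub> y) = \<omega> x \<oplus>\<^bsub>L\<^esub> \<omega> y"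
    and \<omega>s: "\<And>a x. a \<in> carrier F \<Longrightarrow> x \<in> carrier E \<Longrightarrow> \<omega> (a \<odot>\<^bsub>E\<^esub> x) = a \<odot>\<^bsub>L\<^esub> \<omega> x"
    and \<omega>p: "\<And>x y. x \<in> carrier E \<Longrightarrow> y \<in> carrier E \<Longrightarrow> \<omega> (x \<turnstile>\<^bsub>E\<^esub> y) = \<omega> x \<turnstile>\<^bsub>L\<^esub> \<omega> y"
      "\<And>x y. x \<in> carrier E \<Longrightarrow> y \<in> carrier E \<Longrightarrow> \<omega> (x \<stileturn>\<^bsub>E\<^esub> y) = \<omega> x \<stileturn>\<^bsub>L\<^esub> \<omega> y"
      "\<And>x y. x \<in> carrier E \<Longrightarrow> y \<in> carrier E \<Longrightarrow> \<omega> (x \<bottom>\<^bsub>E\<^esub> y) = \<omega> x \<bottom>\<^bsub>L\<^esub> \<omega> y"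
    and \<omega>im: "\<omega> ` carrier E = carrier L"
    using ce unfolding central_extension_def extension_def triassoc_hom_def by auto
  have ker: "\<And>x. x \<in> carrier E \<Longrightarrow> \<omega> x = \<zero>\<^bsub>L\<^esub> \<Longrightarrow> x \<in> center E"
    using ce unfolding central_extension_def a_kernel_def' by blast
  have \<phi>c: "\<And>x. x \<in> carrier E \<Longrightarrow> \<phi> x \<in> carrier F" using \<phi>(1) by auto
  let ?C = "carrier E"
  define \<psi> where "\<psi> x = (\<omega> x, \<phi> x)" for x
  have \<omega>0: "\<omega> \<zero>\<^bsub>E\<^esub> = \<zero>\<^bsub>L\<^esub>" using \<omega>s[of "\<zero>\<^bsub>F\<^esub>" "\<zero>\<^bsub>E\<^esub>"] \<omega>c by simp
  have \<phi>0: "\<phi> \<zero>\<^bsub>E\<^esub> = \<zero>\<^bsub>F\<^esub>" using \<phi>(3)[of "\<zero>\<^bsub>F\<^esub>" "\<zero>\<^bsub>E\<^esub>"] \<phi>c by simp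
  have \<omega>n: "\<omega> (\<ominus>\<^bsub>E\<^esub> x) = \<ominus>\<^bsub>L\<^esub> \<omega> x" if "x \<in> ?C" for x
    using \<omega>a[of "\<ominus>\<^bsub>E\<^esub> x" x] that \<omega>0 \<omega>c by (simp add: E.M.l_neg L.M.minus_equality)
  have same: "b x y = b x' y'"
    if "bilinear_product F E b" and z: "\<And>k y. k \<in> center E \<Longrightarrow> y \<in> ?C \<Longrightarrow> b k y = \<zero>\<^bsub>E\<^esub> \<and> b y k = \<zero>\<^bsub>E\<^esub>"
      and c: "x \<in> ?C" "x' \<in> ?C" "y \<in> ?C" "y' \<in> ?C" and e: "\<psi> x = \<psi> x'" "\<psi> y = \<psi> y'"
    for b x x' y y'
  proof -
    have *: "x \<oplus>\<^bsub>E\<^esub> \<ominus>\<^bsub>E\<^esub> x' \<in> center E" if "x \<in> ?C" "x' \<in> ?C" "\<psi> x = \<psi> x'" for x x'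
      using that \<omega>a \<omega>n \<omega>c by (intro ker) (auto simp: \<psi>_def L.M.r_neg)
    have **: "x = x' \<oplus>\<^bsub>E\<^esub> (x \<oplus>\<^bsub>E\<^esub> \<ominus>\<^bsub>E\<^esub> x')" if "x \<in> ?C" "x' \<in> ?C" for x x'
      using that by (metis E.M.a_comm E.M.a_inv_closed E.M.add.m_closed E.M.a_assoc E.M.r_neg1)
    have cl: "b u v \<in> ?C" if "u \<in> ?C" "v \<in> ?C" for u v
      using \<open>bilinear_product F E b\<close> that unfolding bilinear_product_def by blast
    have "b x y = b (x' \<oplus>\<^bsub>E\<^esub> (x \<oplus>\<^bsub>E\<^esub> \<ominus>\<^bsub>E\<^esub> x')) y" using ** c by metis
    also have "\<dots> = b x' y \<oplus>\<^bsub>E\<^esub> b (x \<oplus>\<^bsub>E\<^esub> \<ominus>\<^bsub>E\<^esub> x') y"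
      using \<open>bilinear_product F E b\<close> c unfolding bilinear_product_def by simp
    also have "\<dots> = b x' y" using z * c e cl by simp
    also have "\<dots> = b x' (y' \<oplus>\<^bsub>E\<^esub> (y \<oplus>\<^bsub>E\<^esub> \<ominus>\<^bsub>E\<^esub> y'))" using ** c by metis
    also have "\<dots> = b x' y' \<oplus>\<^bsub>E\<^esub> b x' (y \<oplus>\<^bsub>E\<^esub> \<ominus>\<^bsub>E\<^esub> y')"
      using \<open>bilinear_product F E b\<close> c unfolding bilinear_product_def by simp
    also have "\<dots> = b x' y'" using z * c e cl by simp
    finally show ?thesis .
  qed
  define r where "r = inv_into ?C \<psi>"
  have r: "r (\<psi> x) \<in> ?C" "\<psi> (r (\<psi> x)) = \<psi> x" if "x \<in> ?C" for x
    using that unfolding r_def by (auto intro: inv_into_into f_inv_into_f)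
  define E1 :: "('f, 'a \<times> 'f) triassoc" where
    "E1 = \<lparr>carrier = \<psi> ` ?C, mult = undefined, one = undefined, zero = (\<zero>\<^bsub>L\<^esub>, \<zero>\<^bsub>F\<^esub>),
      add = (\<lambda>p q. (fst p \<oplus>\<^bsub>L\<^esub> fst q, snd p \<oplus>\<^bsub>F\<^esub> snd q)),
      smult = (\<lambda>a p. (a \<odot>\<^bsub>L\<^esub> fst p, a \<otimes>\<^bsub>F\<^esub> snd p)),
      lprod = (\<lambda>p q. \<psi> (r p \<turnstile>\<^bsub>E\<^esub> r q)), rprod = (\<lambda>p q. \<psi> (r p \<stileturn>\<^bsub>E\<^esub> r q)),
      mprod = (\<lambda>p q. \<psi> (r p \<bottom>\<^bsub>E\<^esub> r q))\<rparr>"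
  have C1: "carrier E1 = \<psi> ` ?C" by (simp add: E1_def)
  have z1: "\<zero>\<^bsub>E1\<^esub> = \<psi> \<zero>\<^bsub>E\<^esub>" by (simp add: E1_def \<psi>_def \<omega>0 \<phi>0)
  have a1: "\<psi> x \<oplus>\<^bsub>E1\<^esub> \<psi> y = \<psi> (x \<oplus>\<^bsub>E\<^esub> y)" if "x \<in> ?C" "y \<in> ?C" for x y
    using that by (simp add: E1_def \<psi>_def \<omega>a \<phi>(2))
  have s1: "a \<odot>\<^bsub>E1\<^esub> \<psi> x = \<psi> (a \<odot>\<^bsub>E\<^esub> x)" if "a \<in> carrier F" "x \<in> ?C" for a x
    using that by (simp add: E1_def \<psi>_def \<omega>s \<phi>(3))
  have p1: "\<psi> x \<turnstile>\<^bsub>E1\<^esub> \<psi> y = \<psi> (x \<turnstile>\<^bsub>E\<^esub> y)"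
      "\<psi> x \<stileturn>\<^bsub>E1\<^esub> \<psi> y = \<psi> (x \<stileturn>\<^bsub>E\<^esub> y)"
      "\<psi> x \<bottom>\<^bsub>E1\<^esub> \<psi> y = \<psi> (x \<bottom>\<^bsub>E\<^esub> y)" if "x \<in> ?C" "y \<in> ?C" for x y
  proof -
    show "\<psi> x \<turnstile>\<^bsub>E1\<^esub> \<psi> y = \<psi> (x \<turnstile>\<^bsub>E\<^esub> y)"
      using same[OF E.bilinear(1), of "r (\<psi> x)" x "r (\<psi> y)" y] that r
      unfolding E1_def center_def by simp
    show "\<psi> x \<stileturn>\<^bsub>E1\<^esub> \<psi> y = \<psi> (x \<stileturn>\<^bsub>E\<^esub> y)"
      using same[OF E.bilinear(2), of "r (\<psi> x)" x "r (\<psi> y)" y] that r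
      unfolding E1_def center_def by simp
    show "\<psi> x \<bottom>\<^bsub>E1\<^esub> \<psi> y = \<psi> (x \<bottom>\<^bsub>E\<^esub> y)"
      using same[OF E.bilinear(3), of "r (\<psi> x)" x "r (\<psi> y)" y] that r
      unfolding E1_def center_def by simp
  qed
  have cl: "x \<turnstile>\<^bsub>E\<^esub> y \<in> ?C" "x \<stileturn>\<^bsub>E\<^esub> y \<in> ?C" "x \<bottom>\<^bsub>E\<^esub> y \<in> ?C"
    if "x \<in> ?C" "y \<in> ?C" for x y
    using E.prod_closed that by auto
  have ab1: "abelian_group E1"
  proof (rule abelian_groupI)
    show "\<exists>y\<in>carrier E1. y \<oplus>\<^bsub>E1\<^esub> x = \<zero>\<^bsub>E1\<^esub>" if "x \<in> carrier E1" for x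
    proof -
      from that obtain u where u: "u \<in> ?C" "x = \<psi> u" unfolding C1 by blast
      then show ?thesis
        by (intro bexI[of _ "\<psi> (\<ominus>\<^bsub>E\<^esub> u)"]) (auto simp: C1 a1 z1 E.M.l_neg)
    qed
  qed (auto simp: C1 a1 z1 E.M.a_ac)
  have mod1: "module F E1"
    by (rule moduleI[OF E.is_cring ab1])
      (auto simp: C1 s1 a1 E.smult_l_distr E.smult_r_distr E.smult_assoc1)
  have alg1: "triassociative_algebra F E1"
  proof (intro triassociative_algebra.intro[OF E.field_axioms mod1] triassociative_algebra_axioms.intro)
    show "bilinear_product F E1 (lprod E1)" "bilinear_product F E1 (rprod E1)"
      "bilinear_product F E1 (mprod E1)"
      using E.bilinear unfolding bilinear_product_def
      by (auto simp: C1 s1 a1 p1 cl)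
  qed (auto simp: C1 p1 cl E.triassoc simp flip: E.triassoc(4,7))
  have hom1: "fst \<in> triassoc_hom F E1 L"
    unfolding triassoc_hom_def
    by (auto simp: C1 a1 s1 p1 cl) (auto simp: \<psi>_def \<omega>a \<omega>s \<omega>p \<omega>c)
  have "fst ` carrier E1 = carrier L" unfolding C1 using \<omega>im by (auto simp: \<psi>_def image_image)
  moreover have "a_kernel E1 L fst \<subseteq> center E1"
  proof
    fix p assume "p \<in> a_kernel E1 L fst"
    then obtain x where x: "x \<in> ?C" "p = \<psi> x" "\<omega> x = \<zero>\<^bsub>L\<^esub>"
      unfolding a_kernel_def' C1 by (auto simp: \<psi>_def)
    then have "x \<in> center E" using ker by blast
    then show "p \<in> center E1"
      using x unfolding center_def by (auto simp: C1 p1 z1)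
  qed
  ultimately have ce1: "central_extension F E1 L fst"
    unfolding central_extension_def extension_def
    using alg1 hom1 L.triassociative_algebra_axioms by blast
  have h: "\<psi> \<in> triassoc_hom F E E1"
    unfolding triassoc_hom_def by (auto simp: C1 a1 s1 p1)
  have \<psi>: "(\<lambda>x. (\<omega> x, \<phi> x)) = \<psi>" by (simp add: \<psi>_def fun_eq_iff)
  show ?thesis unfolding \<psi>
    by (rule exI[of _ E1]) (use ce1 h C1 in \<open>auto simp: E1_def\<close>)
qed

text \<open>The carrier type of \<open>E\<close> is arbitrary here.\<close>

lemma Zstar_subset_image:
  fixes L :: "('f, 'a, 'k) triassoc_scheme" and E :: "('f, 'e, 'n) triassoc_scheme"
  assumes ce: "central_extension F E L \<omega>"
  shows "Zstar F L \<subseteq> \<omega> ` center E"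
proof
  fix z assume z: "z \<in> Zstar F L"
  have zE: "z \<in> \<omega>' ` center E'" if "central_extension F E' L \<omega>'"
    for E' :: "('f, 'a \<times> 'f) triassoc" and \<omega>'
    using z that unfolding Zstar_def by blast
  interpret E: triassociative_algebra F E
    using ce unfolding central_extension_def extension_def by blast
  interpret L: triassociative_algebra F L
    using ce unfolding central_extension_def extension_def by blast
  have \<omega>im: "\<omega> ` carrier E = carrier L" and \<omega>h: "\<omega> \<in> triassoc_hom F E L"
    using ce unfolding central_extension_def extension_def by auto
  have "\<exists>E1 :: ('f, 'a \<times> 'f) triassoc. central_extension F E1 L fst"
    using central_extension_into_product[OF ce, of "\<lambda>_. \<zero>\<^bsub>F\<^esub>"] by auto
  then obtain E0 :: "('f, 'a \<times> 'f) triassoc" where E0: "central_extension F E0 L fst" by blast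
  then have "z \<in> carrier L"
    using zE[OF E0] unfolding central_extension_def extension_def center_def by blast
  then obtain e where e: "e \<in> carrier E" "z = \<omega> e" using \<omega>im by blast
  show "z \<in> \<omega> ` center E"
  proof (rule ccontr)
    assume "z \<notin> \<omega> ` center E"
    then have "e \<notin> center E" using e by blast
    then obtain c where c0: "c \<noteq> \<zero>\<^bsub>E\<^esub>" and x: "\<exists>x\<in>carrier E.
      c \<in> {e \<turnstile>\<^bsub>E\<^esub> x, x \<turnstile>\<^bsub>E\<^esub> e, e \<stileturn>\<^bsub>E\<^esub> x, x \<stileturn>\<^bsub>E\<^esub> e, e \<bottom>\<^bsub>E\<^esub> x, x \<bottom>\<^bsub>E\<^esub> e}"
      using e unfolding center_def by blast
    then obtain x where x: "x \<in> carrier E"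
      "c \<in> {e \<turnstile>\<^bsub>E\<^esub> x, x \<turnstile>\<^bsub>E\<^esub> e, e \<stileturn>\<^bsub>E\<^esub> x, x \<stileturn>\<^bsub>E\<^esub> e, e \<bottom>\<^bsub>E\<^esub> x, x \<bottom>\<^bsub>E\<^esub> e}"
      by blast
    have cl: "x \<turnstile>\<^bsub>E\<^esub> y \<in> carrier E" "x \<stileturn>\<^bsub>E\<^esub> y \<in> carrier E" "x \<bottom>\<^bsub>E\<^esub> y \<in> carrier E"
      if "x \<in> carrier E" "y \<in> carrier E" for x y
      using E.prod_closed that by auto
    have cE: "c \<in> carrier E" using x e cl by auto
    obtain \<phi> where \<phi>: "\<phi> \<in> carrier E \<rightarrow> carrier F"
      "\<forall>x\<in>carrier E. \<forall>y\<in>carrier E. \<phi> (x \<oplus>\<^bsub>E\<^esub> y) = \<phi> x \<oplus>\<^bsub>F\<^esub> \<phi> y"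
      "\<forall>a\<in>carrier F. \<forall>x\<in>carrier E. \<phi> (a \<odot>\<^bsub>E\<^esub> x) = a \<otimes>\<^bsub>F\<^esub> \<phi> x" "\<phi> c = \<one>\<^bsub>F\<^esub>"
      using exists_separating_functional[OF E.triassociative_algebra_axioms cE c0] by blast
    define \<psi> where "\<psi> x = (\<omega> x, \<phi> x)" for x
    have \<psi>: "(\<lambda>x. (\<omega> x, \<phi> x)) = \<psi>" by (simp add: \<psi>_def fun_eq_iff)
    have "\<exists>E1 :: ('f, 'a \<times> 'f) triassoc. central_extension F E1 L fst \<and>
      \<psi> \<in> triassoc_hom F E E1 \<and> \<psi> ` carrier E = carrier E1 \<and> \<zero>\<^bsub>E1\<^esub> = (\<zero>\<^bsub>L\<^esub>, \<zero>\<^bsub>F\<^esub>)"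
      using central_extension_into_product[OF ce \<phi>(1)] \<phi>(2,3) unfolding \<psi> by blast
    then obtain E1 :: "('f, 'a \<times> 'f) triassoc" where E1: "central_extension F E1 L fst"
      "\<psi> \<in> triassoc_hom F E E1" "\<psi> ` carrier E = carrier E1" "\<zero>\<^bsub>E1\<^esub> = (\<zero>\<^bsub>L\<^esub>, \<zero>\<^bsub>F\<^esub>)" by blast
    obtain p where p: "p \<in> center E1" "z = fst p" using zE[OF E1(1)] by blast
    then obtain d where d: "d \<in> carrier E" "p = \<psi> d" using E1(3) unfolding center_def by blast
    define k where "k = e \<oplus>\<^bsub>E\<^esub> \<ominus>\<^bsub>E\<^esub> d"
    have k: "k \<in> carrier E" using e d by (simp add: k_def)
    have \<omega>e: "\<omega> e = \<omega> d" using p d e by (simp add: \<psi>_def)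
    have ek: "e = k \<oplus>\<^bsub>E\<^esub> d" using e d by (simp add: k_def E.M.a_assoc E.M.l_neg)
    have \<omega>c: "\<omega> k \<in> carrier L" "\<omega> d \<in> carrier L" using \<omega>im k d by auto
    have "\<omega> d = \<omega> k \<oplus>\<^bsub>L\<^esub> \<omega> d"
      using ek \<omega>e \<omega>h k d unfolding triassoc_hom_def by auto
    then have "\<omega> k = \<zero>\<^bsub>L\<^esub>" using \<omega>c by (metis L.M.add.r_cancel_one')
    then have kz: "k \<in> center E"
      using ce k unfolding central_extension_def a_kernel_def' by blast
    have eq: "b e x = b d x \<and> b x e = b x d"
      if "bilinear_product F E b" "b k x = \<zero>\<^bsub>E\<^esub>" "b x k = \<zero>\<^bsub>E\<^esub>" for b
      using that k d x(1) unfolding ek bilinear_product_def by simp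
    have "c \<in> {d \<turnstile>\<^bsub>E\<^esub> x, x \<turnstile>\<^bsub>E\<^esub> d, d \<stileturn>\<^bsub>E\<^esub> x, x \<stileturn>\<^bsub>E\<^esub> d, d \<bottom>\<^bsub>E\<^esub> x, x \<bottom>\<^bsub>E\<^esub> d}"
      using x kz eq[OF E.bilinear(1)] eq[OF E.bilinear(2)] eq[OF E.bilinear(3)]
      unfolding center_def by simp
    moreover have "\<psi> (d \<turnstile>\<^bsub>E\<^esub> x) = \<zero>\<^bsub>E1\<^esub>" "\<psi> (x \<turnstile>\<^bsub>E\<^esub> d) = \<zero>\<^bsub>E1\<^esub>"
      "\<psi> (d \<stileturn>\<^bsub>E\<^esub> x) = \<zero>\<^bsub>E1\<^esub>" "\<psi> (x \<stileturn>\<^bsub>E\<^esub> d) = \<zero>\<^bsub>E1\<^esub>"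
      "\<psi> (d \<bottom>\<^bsub>E\<^esub> x) = \<zero>\<^bsub>E1\<^esub>" "\<psi> (x \<bottom>\<^bsub>E\<^esub> d) = \<zero>\<^bsub>E1\<^esub>"
      using p(1) d x(1) E1(2,3) unfolding center_def triassoc_hom_def by auto
    ultimately have "\<psi> c = \<zero>\<^bsub>E1\<^esub>" by auto
    then show False using \<phi>(4) E1(4) by (simp add: \<psi>_def)
  qed
qed

end

theory Submission
  imports Defs
begin

text \<open>Both inclusions are short. A surjective homomorphism maps center into center: each
  element of \<open>L\<close> is some \<omega> y, and a product of \<omega> z with it is the image
  of a product of z with y, hence zero (\<open>extension_image_center_subset\<close>). Conversely, a
  stem extension is central, so the center of \<open>L\<close>, lying in \<open>Zstar F L\<close>,
  lies in the image of the center of \<open>E\<close>. As \<open>Zstar\<close> ranges over carriers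
  in one fixed type while \<open>E\<close> has any type, this rests on
  \<open>Zstar_subset_image\<close>: an element missing from that image is already missed by a
  central extension on a set of pairs (\<omega> x, \<phi> x), for a suitable linear functional
  \<phi>.\<close>

text \<open>\<open>triassoc_hom\<close> does not list preservation of zero. It follows from
  additivity: the image of zero equals its own double, and cancellation in \<open>L\<close>
  applies.\<close>

lemma triassoc_hom_zero:
  assumes "triassociative_algebra F E" "triassociative_algebra F L" "\<omega> \<in> triassoc_hom F E L"
  shows "\<omega> \<zero>\<^bsub>E\<^esub> = \<zero>\<^bsub>L\<^esub>"
proof -
  interpret E: triassociative_algebra F E by fact
  interpret L: triassociative_algebra F L by fact
  have "\<omega> \<zero>\<^bsub>E\<^esub> \<in> carrier L" "\<omega> (\<zero>\<^bsub>E\<^esub> \<oplus>\<^bsub>E\<^esub> \<zero>\<^bsub>E\<^esub>) = \<omega> \<zero>\<^bsub>E\<^esub> \<oplus>\<^bsub>L\<^esub> \<omega> \<zero>\<^bsub>E\<^esub>"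
    using assms(3) E.M.zero_closed unfolding triassoc_hom_def by blast+
  then show ?thesis
    by (metis E.M.l_zero E.M.zero_closed L.M.add.r_cancel_one')
qed

lemma extension_image_center_subset:
  assumes ext: "extension F E L \<omega>"
  shows "\<omega> ` center E \<subseteq> center L"
proof
  have hom: "\<omega> \<in> triassoc_hom F E L" and im: "\<omega> ` carrier E = carrier L"
    using ext unfolding extension_def by auto
  have zero: "\<omega> \<zero>\<^bsub>E\<^esub> = \<zero>\<^bsub>L\<^esub>"
    using ext triassoc_hom_zero unfolding extension_def by blast
  have mult: "\<omega> x \<turnstile>\<^bsub>L\<^esub> \<omega> y = \<omega> (x \<turnstile>\<^bsub>E\<^esub> y)"
      "\<omega> x \<stileturn>\<^bsub>L\<^esub> \<omega> y = \<omega> (x \<stileturn>\<^bsub>E\<^esub> y)"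
      "\<omega> x \<bottom>\<^bsub>L\<^esub> \<omega> y = \<omega> (x \<bottom>\<^bsub>E\<^esub> y)"
    if "x \<in> carrier E" "y \<in> carrier E" for x y
    using hom that unfolding triassoc_hom_def by auto
  fix w assume "w \<in> \<omega> ` center E"
  then obtain z where z: "z \<in> center E" "w = \<omega> z" by blast
  have "z \<in> carrier E" using z unfolding center_def by blast
  then show "w \<in> center L"
    \<comment> \<open>Surjectivity enters here: with \<open>carrier L\<close> rewritten as an image,
      the test elements in \<open>center L\<close> all have preimages in \<open>E\<close>.\<close>
    using z unfolding center_def im[symmetric] by (auto simp: mult zero)
qed

theorem theorem5p6:
  fixes F :: "('f, 'm) ring_scheme"
    and L :: "('f, 'a) triassoc"
  assumes "triassociative_algebra F L"
    and "center L \<subseteq> Zstar F L"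
  shows "\<forall>(E :: ('f, 'e) triassoc) \<omega>. stem_extension F E L \<omega> \<longrightarrow> \<omega> ` center E = center L"
proof (intro allI impI)
  fix E :: "('f, 'e) triassoc" and \<omega>
  assume "stem_extension F E L \<omega>"
  then have ce: "central_extension F E L \<omega>" unfolding stem_extension_def by blast
  show "\<omega> ` center E = center L"
  proof
    show "\<omega> ` center E \<subseteq> center L"
      using ce extension_image_center_subset unfolding central_extension_def by blast
    show "center L \<subseteq> \<omega> ` center E"
      using assms(2) Zstar_subset_image[OF ce] by (rule subset_trans)
  qed
qed

end
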